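(* Let $a$ and $b$ be positive, relatively prime integers and let $S=\{a,b\}$. For an integer $d$, the following are equivalent: (i) $d$ is a dead end in $\mathbb{Z}$ with respect to $S$; (ii) $d$ is a maximal (in the Cayley order) Frobenius value with respect to $S$, i.e., $d$ is a Frobenius value and there is no Frobenius value $d'\neq d$ with $d\le d'$ in the Cayley order.
   Context: For a finite generating set $S$ of $\mathbb{Z}$, the word length $\ell(n)$ of $n\in\mathbb{Z}$ is the least $k$ such that $n=s_1+\dots+s_k$ with each $s_i\in S\cup(-S)$; equivalently it is the graph distance from $0$ to $n$ in the Cayley graph $\Gamma(\mathbb{Z},S)$, whose vertices are the integers and where $m,n$ are adjacent iff $m-n\in S\cup(-S)$. A dead end with respect to $S$ is an integer $d$ with $\ell(d+s)\le \ell(d)$ for every $s\in S\cup(-S)$. The Cayley order is the partial order on $\mathbb{Z}$ with $g\le h$ iff some geodesic path in $\Gamma(\mathbb{Z},S)$ from $0$ to $h$ passes through $g$. For a set $S$ of positive integers with greatest common divisor $1$, an integer $n$ is positively generated if it is a non-negative integer linear combination of elements of $S$, negatively generated if it is a non-positive integer linear combination of elements of $S$, and a Frobenius value with respect to $S$ otherwise. *)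

theory Defs
  imports Main
begin

definition sym_gens :: "int set \<Rightarrow> int set" where
  "sym_gens S = S \<union> uminus ` S"

text \<open>If \<open>S\<close> does not generate the integers, the length of an element outside the generated
  subgroup is an unspecified natural number.\<close>

definition word_length :: "int set \<Rightarrow> int \<Rightarrow> nat" where
  "word_length S n =
     (LEAST k. \<exists>xs. length xs = k \<and> set xs \<subseteq> sym_gens S \<and> n = sum_list xs)"

definition dead_end :: "int set \<Rightarrow> int \<Rightarrow> bool" where
  "dead_end S d \<longleftrightarrow> (\<forall>s \<in> sym_gens S. word_length S (d + s) \<le> word_length S d)"

definition cayley_adj :: "int set \<Rightarrow> int \<Rightarrow> int \<Rightarrow> bool" where
  "cayley_adj S m n \<longleftrightarrow> m - n \<in> sym_gens S"

text \<open>Walks are nonempty lists of vertices; a walk with vertex list \<open>p\<close> has \<open>length p - 1\<close> edges.\<close>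

definition cayley_walk :: "int set \<Rightarrow> int \<Rightarrow> int list \<Rightarrow> int \<Rightarrow> bool" where
  "cayley_walk S u p v \<longleftrightarrow>
     p \<noteq> [] \<and> hd p = u \<and> last p = v \<and> successively (cayley_adj S) p"

definition cayley_geodesic :: "int set \<Rightarrow> int \<Rightarrow> int list \<Rightarrow> int \<Rightarrow> bool" where
  "cayley_geodesic S u p v \<longleftrightarrow>
     cayley_walk S u p v \<and> (\<forall>q. cayley_walk S u q v \<longrightarrow> length p \<le> length q)"

definition cayley_le :: "int set \<Rightarrow> int \<Rightarrow> int \<Rightarrow> bool" where
  "cayley_le S g h \<longleftrightarrow> (\<exists>p. cayley_geodesic S 0 p h \<and> g \<in> set p)"

text \<open>The finite set \<open>F\<close> is there because \<open>sum\<close> over an infinite set is 0.\<close>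

definition positively_generated :: "int set \<Rightarrow> int \<Rightarrow> bool" where
  "positively_generated S n \<longleftrightarrow>
     (\<exists>F c. finite F \<and> F \<subseteq> S \<and> (\<forall>s\<in>F. 0 \<le> c s) \<and> n = (\<Sum>s\<in>F. c s * s))"

definition negatively_generated :: "int set \<Rightarrow> int \<Rightarrow> bool" where
  "negatively_generated S n \<longleftrightarrow>
     (\<exists>F c. finite F \<and> F \<subseteq> S \<and> (\<forall>s\<in>F. c s \<le> 0) \<and> n = (\<Sum>s\<in>F. c s * s))"

definition frobenius_value :: "int set \<Rightarrow> int \<Rightarrow> bool" where
  "frobenius_value S n \<longleftrightarrow> \<not> positively_generated S n \<and> \<not> negatively_generated S n"

definition maximal_frobenius_value :: "int set \<Rightarrow> int \<Rightarrow> bool" where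
  "maximal_frobenius_value S d \<longleftrightarrow>
     frobenius_value S d \<and> \<not> (\<exists>d'. frobenius_value S d' \<and> d' \<noteq> d \<and> cayley_le S d d')"

end

(* Write d = x a - n b. Up to simultaneous shifts of (x, n) by multiples of (b, a), the Frobenius
   values are exactly the points of the open box 0 < x < b, 0 < n < a, and on the closed box the
   length is min (x + n) (a + b - x - n). So a box point is a dead end iff |2(x + n) - (a + b)| <= 1,
   and from any other Frobenius value one of the two steps increasing the length stays in the open
   box. If a <= b, adding b to a positively generated number increases the length by one, so numbers
   that are not Frobenius values are never dead ends. *)

theory Submission
  imports Defs
begin

section \<open>Word length and walks\<close>

lemma sym_gens_uminus_iff [simp]: "- s \<in> sym_gens S \<longleftrightarrow> s \<in> sym_gens S"
  unfolding sym_gens_def by (auto simp: image_iff) (metis minus_equation_iff)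

lemma word_length_le:
  assumes "set xs \<subseteq> sym_gens S"
  shows "word_length S (sum_list xs) \<le> length xs"
  unfolding word_length_def by (rule Least_le) (use assms in blast)

text \<open>The word \<open>ys\<close> makes the set behind the \<open>LEAST\<close> nonempty, so
  \<open>word_length\<close> is the length of an actual word.\<close>

lemma word_length_attained:
  assumes "set ys \<subseteq> sym_gens S" "n = sum_list ys"
  obtains xs where "length xs = word_length S n" "set xs \<subseteq> sym_gens S" "n = sum_list xs"
proof -
  have "\<exists>k xs. length xs = k \<and> set xs \<subseteq> sym_gens S \<and> n = sum_list xs"
    using assms by blast
  from LeastI_ex[OF this] show ?thesis
    unfolding word_length_def[symmetric] using that by blast
qed

lemma cayley_adj_commute: "cayley_adj S m n \<longleftrightarrow> cayley_adj S n m"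
  unfolding cayley_adj_def using sym_gens_uminus_iff[of "m - n" S] by simp

lemma cayley_walk_append:
  assumes "cayley_walk S u p v" "p' \<noteq> [] \<Longrightarrow> cayley_adj S v (hd p')" "successively (cayley_adj S) p'"
  shows "cayley_walk S u (p @ p') (last (v # p'))"
  using assms unfolding cayley_walk_def
  by (cases "p' = []") (auto simp: successively_append_iff)

text \<open>The differences of consecutive vertices spell a word for \<open>v\<close>, one letter
  per edge. The inequality is strict because \<open>length p\<close> counts vertices.\<close>

lemma word_length_walk_le:
  assumes "cayley_walk S 0 p v"
  shows "word_length S v < length p"
proof -
  have "\<exists>xs. Suc (length xs) = length p \<and> set xs \<subseteq> sym_gens S \<and> last p = sum_list xs"
    if "p \<noteq> []" "hd p = 0" "successively (cayley_adj S) p" for p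
    using that
  proof (induction p rule: rev_nonempty_induct)
    case (single x)
    then show ?case by simp
  next
    case (snoc x p)
    then obtain xs where xs: "Suc (length xs) = length p" "set xs \<subseteq> sym_gens S" "last p = sum_list xs"
      by (auto simp: successively_append_iff)
    have "x - last p \<in> sym_gens S"
      using snoc cayley_adj_commute[of S x] by (auto simp: successively_append_iff cayley_adj_def)
    then show ?case
      using xs by (intro exI[of _ "xs @ [x - last p]"]) auto
  qed
  then obtain xs where "Suc (length xs) = length p" "set xs \<subseteq> sym_gens S" "v = sum_list xs"
    using assms unfolding cayley_walk_def by metis
  then show ?thesis using word_length_le[of xs S] by simp
qed

text \<open>The vertices are the partial sums of the word, starting with 0.\<close>

lemma cayley_walk_of_word:
  assumes "set xs \<subseteq> sym_gens S"
  shows "\<exists>p. cayley_walk S 0 p (sum_list xs) \<and> length p = Suc (length xs)"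
  using assms
proof (induction xs rule: rev_induct)
  case Nil
  show ?case by (intro exI[of _ "[0]"]) (simp add: cayley_walk_def)
next
  case (snoc x xs)
  then obtain p where p: "cayley_walk S 0 p (sum_list xs)" "length p = Suc (length xs)" by auto
  have "cayley_walk S 0 (p @ [sum_list xs + x]) (last [sum_list xs, sum_list xs + x])"
    using cayley_walk_append[OF p(1), of "[sum_list xs + x]"] snoc.prems by (auto simp: cayley_adj_def)
  then show ?case using p by (intro exI[of _ "p @ [sum_list xs + x]"]) simp
qed

section \<open>Dead ends and the Cayley order for a generating set\<close>

locale generating =
  fixes S :: "int set"
  assumes generated: "\<exists>xs. set xs \<subseteq> sym_gens S \<and> n = sum_list xs"
begin

lemma shortest_walk: "\<exists>p. cayley_walk S 0 p v \<and> length p = Suc (word_length S v)"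
proof -
  obtain ys where "set ys \<subseteq> sym_gens S" "v = sum_list ys" using generated by blast
  then obtain xs where "length xs = word_length S v" "set xs \<subseteq> sym_gens S" "v = sum_list xs"
    by (rule word_length_attained)
  then show ?thesis using cayley_walk_of_word[of xs S] by simp
qed

text \<open>A geodesic running on from \<open>d\<close> to a neighbour \<open>e\<close> could be
  shortened: the length of \<open>e\<close> is at most that of \<open>d\<close>, so a shortest walk
  to \<open>e\<close> beats the initial segment through \<open>d\<close>. Hence the geodesic ends at
  \<open>d\<close>.\<close>

lemma dead_end_maximal:
  assumes "dead_end S d" "cayley_le S d d'"
  shows "d' = d"
proof -
  obtain p where p: "cayley_geodesic S 0 p d'" "d \<in> set p"
    using assms(2) unfolding cayley_le_def by blast
  then obtain p1 p2 where split: "p = p1 @ d # p2" by (meson split_list)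
  have walk: "cayley_walk S 0 p d'" using p(1) by (simp add: cayley_geodesic_def)
  show ?thesis
  proof (cases p2)
    case Nil
    then show ?thesis using walk split by (simp add: cayley_walk_def)
  next
    case (Cons e p3)
    have "cayley_walk S 0 (p1 @ [d]) d"
      using walk split successively_append_iff[of _ "p1 @ [d]" p2]
      by (auto simp: cayley_walk_def hd_append)
    then have len: "word_length S d < length (p1 @ [d])" by (rule word_length_walk_le)
    have "cayley_adj S e d"
      using walk split Cons cayley_adj_commute[of S e]
      by (auto simp: cayley_walk_def successively_append_iff)
    then have "word_length S e \<le> word_length S d"
      using assms(1) unfolding dead_end_def cayley_adj_def by (metis add.commute diff_add_cancel)
    moreover obtain q where q: "cayley_walk S 0 q e" "length q = Suc (word_length S e)"
      using shortest_walk by blast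
    moreover have "cayley_walk S 0 (q @ p3) (last (e # p3))"
      using walk split Cons
      by (intro cayley_walk_append[OF q(1)])
        (auto simp: cayley_walk_def successively_append_iff successively_Cons)
    moreover have "last (e # p3) = d'"
      using walk split Cons by (simp add: cayley_walk_def)
    ultimately have "length p \<le> length (q @ p3)"
      using p(1) unfolding cayley_geodesic_def by metis
    \<comment> \<open>Replacing \<open>p1 @ [d, e]\<close> by \<open>q\<close> saves a vertex:
      \<open>q\<close> has at most \<open>Suc (word_length S d)\<close> vertices, and
      \<open>p1 @ [d]\<close> has at least that many.\<close>
    then show ?thesis using len q split Cons \<open>word_length S e \<le> word_length S d\<close> by simp
  qed
qed

text \<open>Appending \<open>d + s\<close> to a shortest walk to \<open>d\<close> gives
  \<open>word_length S d + 2\<close> vertices, and every walk to \<open>d + s\<close> has at least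
  that many.\<close>

lemma cayley_le_step:
  assumes "s \<in> sym_gens S" "word_length S d < word_length S (d + s)"
  shows "cayley_le S d (d + s)"
proof -
  obtain q where q: "cayley_walk S 0 q d" "length q = Suc (word_length S d)"
    using shortest_walk by blast
  have "cayley_walk S 0 (q @ [d + s]) (d + s)"
    using cayley_walk_append[OF q(1), of "[d + s]"] assms(1) by (simp add: cayley_adj_def)
  moreover have "length (q @ [d + s]) \<le> length q'" if "cayley_walk S 0 q' (d + s)" for q'
    using word_length_walk_le[OF that] assms(2) q(2) by simp
  moreover have "d \<in> set (q @ [d + s])"
    using q(1) last_in_set[of q] by (auto simp: cayley_walk_def)
  ultimately show ?thesis unfolding cayley_le_def cayley_geodesic_def by blast
qed

end

lemma negatively_generated_iff: "negatively_generated S n \<longleftrightarrow> positively_generated S (- n)"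
proof
  assume "negatively_generated S n"
  then obtain F c where "finite F" "F \<subseteq> S" "\<forall>s\<in>F. c s \<le> 0" "n = (\<Sum>s\<in>F. c s * s)"
    unfolding negatively_generated_def by blast
  then show "positively_generated S (- n)"
    unfolding positively_generated_def
    by (intro exI[of _ F] exI[of _ "\<lambda>s. - c s"]) (simp add: sum_negf)
next
  assume "positively_generated S (- n)"
  then obtain F c where "finite F" "F \<subseteq> S" "\<forall>s\<in>F. 0 \<le> c s" "- n = (\<Sum>s\<in>F. c s * s)"
    unfolding positively_generated_def by blast
  then show "negatively_generated S n"
    unfolding negatively_generated_def
    by (intro exI[of _ F] exI[of _ "\<lambda>s. - c s"]) (simp add: sum_negf)
qed

section \<open>Two coprime generators\<close>

lemma sym_gens_pair: "sym_gens {a, b} = {a, b, - a, - b}"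
  unfolding sym_gens_def by auto

lemma positively_generated_pair:
  "positively_generated {a, b} n \<longleftrightarrow> (\<exists>x y. 0 \<le> x \<and> 0 \<le> y \<and> n = x * a + y * b)"
proof
  assume "positively_generated {a, b} n"
  then obtain F c where F: "F \<subseteq> {a, b}" "\<forall>s\<in>F. 0 \<le> c s" "n = (\<Sum>s\<in>F. c s * s)"
    unfolding positively_generated_def by blast
  \<comment> \<open>Extending the coefficients by zero lets the sum range over all of
    \<open>{a, b}\<close>.\<close>
  define c' where "c' s = (if s \<in> F then c s else 0)" for s
  have n: "n = (\<Sum>s\<in>{a, b}. c' s * s)"
    unfolding F(3) c'_def using F(1) by (intro sum.mono_neutral_cong_left) auto
  have "0 \<le> c' a" "0 \<le> c' b" using F(2) by (simp_all add: c'_def)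
  show "\<exists>x y. 0 \<le> x \<and> 0 \<le> y \<and> n = x * a + y * b"
  \<comment> \<open>For \<open>a = b\<close> the set has one element, whose single coefficient
    serves both generators.\<close>
  proof (cases "a = b")
    case True
    then show ?thesis
      using n \<open>0 \<le> c' a\<close> by (intro exI[of _ "c' a"] exI[of _ 0]) simp
  next
    case False
    then show ?thesis
      using n \<open>0 \<le> c' a\<close> \<open>0 \<le> c' b\<close> by (intro exI[of _ "c' a"] exI[of _ "c' b"]) simp
  qed
next
  assume "\<exists>x y. 0 \<le> x \<and> 0 \<le> y \<and> n = x * a + y * b"
  then obtain x y where xy: "0 \<le> x" "0 \<le> y" "n = x * a + y * b" by blast
  show "positively_generated {a, b} n"
  proof (cases "a = b")
    case True
    then show ?thesis
      unfolding positively_generated_def using xy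
      by (intro exI[of _ "{a}"] exI[of _ "\<lambda>_. x + y"]) (auto simp: algebra_simps)
  next
    case False
    then show ?thesis
      unfolding positively_generated_def using xy
      by (intro exI[of _ "{a, b}"] exI[of _ "\<lambda>s. if s = a then x else y"]) auto
  qed
qed

lemma word_pair:
  obtains xs where "int (length xs) = \<bar>x\<bar> + \<bar>y\<bar>" "set xs \<subseteq> sym_gens {a, b}" "x * a + y * b = sum_list xs"
proof (rule that)
  \<comment> \<open>The sign selects a generator or its negative. For a zero coefficient the list is
    empty, so \<open>sgn 0 = 0\<close> never produces a letter.\<close>
  let ?xs = "replicate (nat \<bar>x\<bar>) (sgn x * a) @ replicate (nat \<bar>y\<bar>) (sgn y * b)"
  show "int (length ?xs) = \<bar>x\<bar> + \<bar>y\<bar>" by simp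
  show "set ?xs \<subseteq> sym_gens {a, b}" by (auto simp: sym_gens_pair sgn_if)
  show "x * a + y * b = sum_list ?xs"
    by (simp add: sum_list_replicate abs_mult_sgn flip: mult.assoc)
qed

lemma word_length_pair_le: "int (word_length {a, b} (x * a + y * b)) \<le> \<bar>x\<bar> + \<bar>y\<bar>"
  by (metis word_pair word_length_le of_nat_le_iff)

text \<open>Collecting letters may cancel opposite ones, hence an inequality only.\<close>

lemma sum_list_pair:
  assumes "set xs \<subseteq> sym_gens {a, b}"
  shows "\<exists>x y. sum_list xs = x * a + y * b \<and> \<bar>x\<bar> + \<bar>y\<bar> \<le> int (length xs)"
  using assms
proof (induction xs)
  case Nil
  show ?case by (intro exI[of _ 0]) simp
next
  case (Cons s xs)
  then obtain x y where xy: "sum_list xs = x * a + y * b" "\<bar>x\<bar> + \<bar>y\<bar> \<le> int (length xs)" by auto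
  have "\<exists>u v. s = u * a + v * b \<and> \<bar>u\<bar> + \<bar>v\<bar> \<le> 1"
  proof -
    consider "s = 1 * a + 0 * b" | "s = 0 * a + 1 * b" | "s = (-1) * a + 0 * b" | "s = 0 * a + (-1) * b"
      using Cons.prems by (auto simp: sym_gens_pair)
    then show ?thesis by cases fastforce+
  qed
  then obtain u v where "s = u * a + v * b" "\<bar>u\<bar> + \<bar>v\<bar> \<le> 1" by blast
  then show ?case
    using xy by (intro exI[of _ "u + x"] exI[of _ "v + y"]) (simp add: algebra_simps)
qed

section \<open>Representations and length for coprime \<open>a\<close> and \<open>b\<close>\<close>

locale coprime_pair =
  fixes a b :: int
  assumes pos: "0 < a" "0 < b" and coprime: "coprime a b"
begin

abbreviation len :: "int \<Rightarrow> int" where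
  "len n \<equiv> int (word_length {a, b} n)"

lemma reduced_rep:
  obtains x y where "n = x * a + y * b" "0 \<le> x" "x < b"
proof -
  obtain u v where uv: "u * a + v * b = 1"
    using bezout_int[of a b] coprime by auto
  \<comment> \<open>Scale the Bezout identity by \<open>n\<close>, then move the multiple of
    \<open>b\<close> in the coefficient of \<open>a\<close> over to the coefficient of
    \<open>b\<close>.\<close>
  have "n = (n * u mod b) * a + (n * u div b * a + n * v) * b"
  proof -
    have "n = (n * u) * a + (n * v) * b"
      using uv by (metis distrib_left mult.assoc mult.right_neutral)
    also have "n * u = n * u div b * b + n * u mod b" by simp
    finally show ?thesis by (simp only: distrib_right mult.assoc mult.commute[of a b] add_ac)
  qed
  then show ?thesis using that pos by simp
qed

text \<open>The divisor \<open>b\<close> of \<open>(x' - x) * a\<close> is coprime to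
  \<open>a\<close>, so it divides \<open>x' - x\<close>.\<close>

lemma rep_unique:
  assumes "x * a + y * b = x' * a + y' * b"
  obtains k where "x' = x + k * b" "y' = y - k * a"
proof -
  have eq: "(x' - x) * a = (y - y') * b" using assms by (simp add: algebra_simps)
  then have "b dvd x' - x"
    using coprime by (metis coprime_commute coprime_dvd_mult_left_iff dvd_triv_right)
  then obtain k where k: "x' - x = k * b" by (metis dvdE mult.commute)
  then have "(y - y') * b = (k * a) * b" using eq by (metis mult.assoc mult.commute)
  then have "y - y' = k * a" using pos(2) by (metis less_irrefl mult_cancel_right)
  then show ?thesis using that[of k] k by simp
qed

sublocale generating "{a, b}"
proof
  fix n
  obtain x y where "n = x * a + y * b" using reduced_rep .
  then show "\<exists>xs. set xs \<subseteq> sym_gens {a, b} \<and> n = sum_list xs" by (metis word_pair)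
qed

text \<open>A shortest word yields a representation of cost at most the length, and no
  representation costs less than the length. By \<open>rep_unique\<close> it is a shift of the given
  one.\<close>

lemma len_attained:
  obtains k where "len (x * a + y * b) = \<bar>x + k * b\<bar> + \<bar>y - k * a\<bar>"
proof -
  let ?n = "x * a + y * b"
  obtain ys where "set ys \<subseteq> sym_gens {a, b}" "?n = sum_list ys" using generated by blast
  then obtain xs where xs: "length xs = word_length {a, b} ?n" "set xs \<subseteq> sym_gens {a, b}" "?n = sum_list xs"
    by (rule word_length_attained)
  then obtain x' y' where xy: "?n = x' * a + y' * b" "\<bar>x'\<bar> + \<bar>y'\<bar> \<le> len ?n"
    using sum_list_pair[OF xs(2)] by auto
  then obtain k where "x' = x + k * b" "y' = y - k * a" using rep_unique by blast
  then show ?thesis using that[of k] xy word_length_pair_le[of a b x' y'] by simp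
qed

lemma len_uminus: "len (- n) = len n"
proof -
  have "len (- m) \<le> len m" for m
  proof -
    obtain x y where m: "m = x * a + y * b" using reduced_rep .
    obtain k where k: "len m = \<bar>x + k * b\<bar> + \<bar>y - k * a\<bar>" using len_attained m by blast
    have "- m = (- (x + k * b)) * a + (- (y - k * a)) * b" using m by (simp add: algebra_simps)
    then show ?thesis using k word_length_pair_le[of a b "- (x + k * b)" "- (y - k * a)"]
      by (metis abs_minus_cancel)
  qed
  from this[of n] this[of "- n"] show ?thesis by simp
qed

text \<open>The two terms are the costs of the representations \<open>(x, - n)\<close> and
  \<open>(x - b, a - n)\<close>. The closed box also covers all neighbours of open box
  points.\<close>

lemma len_box:
  assumes "0 \<le> x" "x \<le> b" "0 \<le> n" "n \<le> a"
  shows "len (x * a - n * b) = min (x + n) (a + b - (x + n))"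
proof (rule antisym)
  have "len (x * a - n * b) \<le> x + n"
    using word_length_pair_le[of a b x "- n"] assms by simp
  moreover have "len (x * a - n * b) \<le> a + b - (x + n)"
    using word_length_pair_le[of a b "x - b" "a - n"] assms by (simp add: algebra_simps)
  ultimately show "len (x * a - n * b) \<le> min (x + n) (a + b - (x + n))" by simp
  obtain k where k: "len (x * a - n * b) = \<bar>x + k * b\<bar> + \<bar>- n - k * a\<bar>"
    using len_attained[of x "- n"] by auto
  \<comment> \<open>Shifts with \<open>k \<ge> 0\<close> cost at least as much as
    \<open>k = 0\<close>, the others at least as much as \<open>k = - 1\<close>.\<close>
  show "min (x + n) (a + b - (x + n)) \<le> len (x * a - n * b)"
  proof (cases "0 \<le> k")
    case True
    then have "0 \<le> k * b" "0 \<le> k * a" using pos by auto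
    then show ?thesis using k by linarith
  next
    case False
    then have "k * b \<le> - b" "k * a \<le> - a"
      using pos mult_right_mono[of k "- 1" a] mult_right_mono[of k "- 1" b] by simp_all
    then show ?thesis using k by linarith
  qed
qed

section \<open>Frobenius values as points of the open box\<close>

lemma frobenius_value_box:
  "frobenius_value {a, b} d \<longleftrightarrow> (\<exists>x n. d = x * a - n * b \<and> 0 < x \<and> x < b \<and> 0 < n \<and> n < a)"
proof
  assume F: "frobenius_value {a, b} d"
  obtain x y where xy: "d = x * a + y * b" "0 \<le> x" "x < b" using reduced_rep .
  have "\<not> 0 \<le> y"
    using F xy unfolding frobenius_value_def positively_generated_pair by blast
  moreover have "\<not> (\<exists>u v. 0 \<le> u \<and> 0 \<le> v \<and> - d = u * a + v * b)"
    using F unfolding frobenius_value_def negatively_generated_iff positively_generated_pair by blast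
  then have neg: "- d \<noteq> u * a + v * b" if "0 \<le> u" "0 \<le> v" for u v using that by blast
  have "x \<noteq> 0" using neg[of 0 "- y"] xy \<open>\<not> 0 \<le> y\<close> by auto
  moreover have "- a < y"
  \<comment> \<open>If \<open>y \<le> - a\<close>, the shift to \<open>(x - b, y + a)\<close> makes
    both coefficients nonpositive.\<close>
  proof (rule ccontr)
    assume "\<not> - a < y"
    then show False using neg[of "b - x" "- a - y"] xy by (simp add: algebra_simps)
  qed
  ultimately show "\<exists>x n. d = x * a - n * b \<and> 0 < x \<and> x < b \<and> 0 < n \<and> n < a"
    using xy by (intro exI[of _ x] exI[of _ "- y"]) auto
next
  assume "\<exists>x n. d = x * a - n * b \<and> 0 < x \<and> x < b \<and> 0 < n \<and> n < a"
  then obtain x n where xn: "d = x * a + (- n) * b" "0 < x" "x < b" "0 < n" "n < a" by auto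
  \<comment> \<open>No shift of a box point leaves the region of strictly opposite signs:
    \<open>k \<ge> 0\<close> keeps both signs and \<open>k \<le> - 1\<close> reverses both.\<close>
  have mixed: "x + k * b > 0 \<and> - n - k * a < 0 \<or> x + k * b < 0 \<and> - n - k * a > 0" for k
  proof (cases "0 \<le> k")
    case True
    then have "0 \<le> k * b" "0 \<le> k * a" using pos by auto
    then have "x + k * b > 0" "- n - k * a < 0" using xn by linarith+
    then show ?thesis by simp
  next
    case False
    then have "k * b \<le> - b" "k * a \<le> - a"
      using pos mult_right_mono[of k "- 1" a] mult_right_mono[of k "- 1" b] by simp_all
    then have "x + k * b < 0" "- n - k * a > 0" using xn by linarith+
    then show ?thesis by simp
  qed
  have reps: "u > 0 \<and> v < 0 \<or> u < 0 \<and> v > 0" if "d = u * a + v * b" for u v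
  proof -
    have "x * a + (- n) * b = u * a + v * b" using xn(1) that by simp
    then obtain k where "u = x + k * b" "v = - n - k * a" by (rule rep_unique)
    then show ?thesis using mixed[of k] by simp
  qed
  have "\<not> positively_generated {a, b} d"
    unfolding positively_generated_pair by (meson reps leD)
  moreover have "\<not> positively_generated {a, b} (- d)"
    unfolding positively_generated_pair
  proof safe
    fix u v assume "0 \<le> u" "0 \<le> v" "- d = u * a + v * b"
    then show False using reps[of "- u" "- v"] by auto
  qed
  ultimately show "frobenius_value {a, b} d"
    by (simp add: frobenius_value_def negatively_generated_iff)
qed

section \<open>Dead ends are Frobenius values\<close>

lemma len_add_larger:
  assumes "a \<le> b" "positively_generated {a, b} d"
  shows "len d < len (d + b)"
proof -
  obtain x y where xy: "0 \<le> x" "0 \<le> y" "d = x * a + y * b"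
    using assms(2) unfolding positively_generated_pair by blast
  have "d + b = x * a + (y + 1) * b" using xy by (simp add: algebra_simps)
  then obtain k where k: "len (d + b) = \<bar>x + k * b\<bar> + \<bar>y + 1 - k * a\<bar>"
    using len_attained by metis
  show ?thesis
  \<comment> \<open>For \<open>k \<le> 0\<close> the coefficient of \<open>b\<close> in the shortest
    representation of \<open>d + b\<close> is positive, and lowering it by one represents
    \<open>d\<close> at a smaller cost.\<close>
  proof (cases "k \<le> 0")
    case True
    then have "k * a \<le> 0" using pos by (simp add: mult_nonpos_nonneg)
    moreover have "d = (x + k * b) * a + (y - k * a) * b" using xy by (simp add: algebra_simps)
    then have "len d \<le> \<bar>x + k * b\<bar> + \<bar>y - k * a\<bar>" using word_length_pair_le by metis
    ultimately show ?thesis using k xy by linarith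
  next
    case False
    \<comment> \<open>For \<open>k > 0\<close> the shift adds \<open>k * b\<close> to one
      coefficient and takes only \<open>k * a\<close> from the other, so the cost is at least
      \<open>x + y + 1\<close>.\<close>
    then have "k * a \<le> k * b" using assms(1) by (simp add: mult_left_mono)
    moreover have "len d \<le> \<bar>x\<bar> + \<bar>y\<bar>" using word_length_pair_le xy by metis
    ultimately show ?thesis using k xy by linarith
  qed
qed

lemma dead_end_iff_len: "dead_end {a, b} d \<longleftrightarrow> (\<forall>s \<in> {a, b, - a, - b}. len (d + s) \<le> len d)"
  by (simp add: dead_end_def sym_gens_pair)

lemma dead_end_frobenius_value_aux:
  assumes "a \<le> b" "dead_end {a, b} d"
  shows "frobenius_value {a, b} d"
proof -
  have "\<not> positively_generated {a, b} d"
    using len_add_larger[OF assms(1)] assms(2) by (fastforce simp: dead_end_iff_len)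
  moreover have "\<not> positively_generated {a, b} (- d)"
  proof
    assume "positively_generated {a, b} (- d)"
    \<comment> \<open>Reflection in 0 preserves length and turns the step by \<open>b\<close> into
      one by \<open>- b\<close>.\<close>
    from len_add_larger[OF assms(1) this] have "len d < len (d - b)"
      using len_uminus[of d] len_uminus[of "d - b"] by simp
    then show False using assms(2) by (simp add: dead_end_iff_len)
  qed
  ultimately show ?thesis by (simp add: frobenius_value_def negatively_generated_iff)
qed

lemma dead_end_frobenius_value:
  assumes "dead_end {a, b} d"
  shows "frobenius_value {a, b} d"
proof (cases "a \<le> b")
  case True
  then show ?thesis using assms by (rule dead_end_frobenius_value_aux)
next
  case False
  \<comment> \<open>Both notions depend only on the set \<open>{a, b}\<close>, so the generators may
    be exchanged to put the larger one second.\<close>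
  interpret swap: coprime_pair b a
    using pos coprime by unfold_locales (auto simp: coprime_commute)
  show ?thesis
    using swap.dead_end_frobenius_value_aux[of d] False assms by (simp add: insert_commute)
qed

section \<open>Dead ends and maximality near the middle of the box\<close>

lemma dead_end_box:
  assumes "0 < x" "x < b" "0 < n" "n < a" "\<bar>2 * (x + n) - (a + b)\<bar> \<le> 1"
  shows "dead_end {a, b} (x * a - n * b)"
proof -
  have step: "x * a - n * b + a = (x + 1) * a - n * b" "x * a - n * b + b = x * a - (n - 1) * b"
    "x * a - n * b + - a = (x - 1) * a - n * b" "x * a - n * b + - b = x * a - (n + 1) * b"
    by (simp_all add: algebra_simps)
  have le: "len (x' * a - n' * b) \<le> len (x * a - n * b)"
    if "0 \<le> x'" "x' \<le> b" "0 \<le> n'" "n' \<le> a" "x' + n' = x + n + 1 \<or> x' + n' = x + n - 1" for x' n'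
  proof -
    \<comment> \<open>So \<open>x + n\<close> is an integer nearest to \<open>(a + b) / 2\<close>,
      where \<open>min t (a + b - t)\<close> is largest over the integers \<open>t\<close>.\<close>
    have "a + b - 1 \<le> 2 * (x + n)" "2 * (x + n) \<le> a + b + 1"
      using assms(5) by linarith+
    then have "min (x' + n') (a + b - (x' + n')) \<le> min (x + n) (a + b - (x + n))"
      using that(5) by (elim disjE) (simp_all add: min_def)
    then show ?thesis using assms that by (simp only: len_box less_imp_le)
  qed
  show ?thesis
    unfolding dead_end_iff_len
    using assms(1-4) le[of "x + 1" n] le[of x "n - 1"] le[of "x - 1" n] le[of x "n + 1"]
    by (simp only: ball_simps step) simp
qed

text \<open>A longer neighbour lies above \<open>d\<close> by \<open>cayley_le_step\<close>, so it
  cannot be a Frobenius value.\<close>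

lemma maximal_frobenius_value_step:
  assumes "maximal_frobenius_value {a, b} d" "s \<in> {a, b, - a, - b}" "frobenius_value {a, b} (d + s)"
  shows "len (d + s) \<le> len d"
proof (rule ccontr)
  assume "\<not> len (d + s) \<le> len d"
  then have "cayley_le {a, b} d (d + s)"
    using assms(2) by (intro cayley_le_step) (auto simp: sym_gens_pair)
  moreover have "d + s \<noteq> d" using assms(2) pos by auto
  ultimately show False using assms unfolding maximal_frobenius_value_def by blast
qed

text \<open>Away from the middle, a unit step in \<open>x\<close> or \<open>n\<close> towards it
  stays in the open box and increases the length, against maximality.\<close>

lemma maximal_frobenius_value_dead_end:
  assumes max: "maximal_frobenius_value {a, b} d"
  shows "dead_end {a, b} d"
proof -
  obtain x n where d: "d = x * a - n * b" and box: "0 < x" "x < b" "0 < n" "n < a"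
    using max unfolding maximal_frobenius_value_def frobenius_value_box by blast
  have step: "min (x' + n') (a + b - (x' + n')) \<le> min (x + n) (a + b - (x + n))"
    if "0 < x'" "x' < b" "0 < n'" "n' < a" "x' * a - n' * b - d \<in> {a, b, - a, - b}" for x' n'
    using maximal_frobenius_value_step[OF max that(5)] that box
    by (force simp: frobenius_value_box len_box d)
  have "\<bar>2 * (x + n) - (a + b)\<bar> \<le> 1"
  proof (rule ccontr)
    assume "\<not> ?thesis"
    \<comment> \<open>If both steps left the open box, then \<open>x = b - 1\<close>,
      \<open>n = a - 1\<close> or \<open>x = n = 1\<close>. Either forces
      \<open>a + b \<le> 2\<close>, but an open box with an integer point has
      \<open>a, b \<ge> 2\<close>.\<close>
    then consider "2 * (x + n) \<le> a + b - 2" "x + 1 < b" | "2 * (x + n) \<le> a + b - 2" "n + 1 < a"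
      | "2 * (x + n) \<ge> a + b + 2" "1 < x" | "2 * (x + n) \<ge> a + b + 2" "1 < n"
      using box by smt
    then show False
    proof cases
      case 1
      then show False using step[of "x + 1" n] box by (auto simp: d algebra_simps)
    next
      case 2
      then show False using step[of x "n + 1"] box by (auto simp: d algebra_simps)
    next
      case 3
      then show False using step[of "x - 1" n] box by (auto simp: d algebra_simps)
    next
      case 4
      then show False using step[of x "n - 1"] box by (auto simp: d algebra_simps)
    qed
  qed
  then show ?thesis unfolding d using box by (intro dead_end_box)
qed

end

theorem theorem1:
  fixes a b d :: int
  assumes "0 < a" and "0 < b" and "coprime a b"
  shows "dead_end {a, b} d \<longleftrightarrow> maximal_frobenius_value {a, b} d"
proof -
  interpret coprime_pair a b using assms by unfold_locales
  \<comment> \<open>A dead end lies below no other integer at all, in particular below no other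
    Frobenius value.\<close>
  show ?thesis
    using maximal_frobenius_value_dead_end dead_end_frobenius_value dead_end_maximal
    unfolding maximal_frobenius_value_def by blast
qed

end
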